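(* Consider a BDAM instance in the notation of the context. For every defender plan $(X,y)$ with binary $X_v$ and $y(u,v)$, the attacker's shortest-path length satisfies $$H(X,y)=\max\{\pi_t \;:\; \pi\in\mathbb{R}^V,\ \pi_s=0,\ \pi_v-\pi_u\le \delta^A(u,v)\ \text{ for every ordered pair } (u,v) \text{ with } \{u,v\}\in E\}.$$ Consequently, the maximum $H^*$ of $H(X,y)$ over all feasible defender decisions $(X,y,I)$ equals the optimal value of the single-level problem $$\max_{X,y,I,\pi}\ \pi_t\quad\text{s.t.}\quad (X,y,I)\ \text{feasible},\ \ \pi\in\mathbb{R}^V,\ \ \pi_s=0,\ \ \pi_v-\pi_u\le d(u,v)\bigl(1+g_1X_v+g_2\,y(u,v)\bigr)\ \text{ for every ordered pair } (u,v) \text{ with } \{u,v\}\in E,$$ and this problem is a mixed-integer linear program: its objective and all its constraints are linear in $(X,y,I,\pi)$, where $X,y,I$ are binary and $\pi$ is continuous.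
   Context: A BDAM (bi-level dual-defense attacker model) instance consists of: a finite simple undirected graph $G=(V,E)$ with positive edge lengths $d(u,v)=d(v,u)>0$; distinct nodes $s$ (source) and $t$ (terminal), with $t$ reachable from $s$; a set $N\subseteq V$ of nodes eligible for interdiction and a set $E'\subseteq E$ of edges eligible for destruction; an edge-destruction budget $R\ge 0$; a finite set $S$ of supply nodes with capacities $c_j\ge 0$ ($j\in S$); and weights $g_1,g_2\ge 0$. Defender decisions: $X_v\in\{0,1\}$ for $v\in V$ (node interdiction, $X_v=0$ for $v\notin N$); $y(u,v)=y(v,u)\in\{0,1\}$ for $\{u,v\}\in E$ (edge destruction, $y=0$ outside $E'$); and an assignment $I(v,j)\in\{0,1\}$ for $v\in V$, $j\in S$. The triple $(X,y,I)$ is feasible if $\sum_{\{u,v\}\in E}y(u,v)\le R$, every interdicted node is assigned to exactly one supply node ($\sum_{j\in S}I(v,j)=X_v$ for all $v$), and capacities are respected ($\sum_{v}I(v,j)\le c_j$ for all $j\in S$). The interdicted length of traversing edge $\{u,v\}$ from $u$ to $v$ is $\delta^A(u,v)=d(u,v)\bigl(1+g_1X_v+g_2\,y(u,v)\bigr)$. The attacker's shortest-path length is $H(X,y)=\min_{P}\sum_{(u,v)\in P}\delta^A(u,v)$, the minimum over all $s$-$t$ paths $P$ in $G$, each edge being counted in its direction of traversal from $s$ to $t$. *)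

theory Defs
  imports Complex_Main
begin

section \<open>Maxima and mathematical programs\<close>

definition is_maximum :: "real set \<Rightarrow> real \<Rightarrow> bool" where
  "is_maximum A m \<longleftrightarrow> m \<in> A \<and> (\<forall>a\<in>A. a \<le> m)"

datatype var_kind = Binary | Integer | Continuous

fun kind_domain :: "var_kind \<Rightarrow> real set" where
  "kind_domain Binary = {0, 1}"
| "kind_domain Integer = \<int>"
| "kind_domain Continuous = UNIV"

datatype 'i constr =
    Leq "('i \<Rightarrow> real) \<Rightarrow> real" "('i \<Rightarrow> real) \<Rightarrow> real"
  | Eq "('i \<Rightarrow> real) \<Rightarrow> real" "('i \<Rightarrow> real) \<Rightarrow> real"

text \<open>
  A maximisation problem.  Nothing is assumed about the shape of the objective and of the two
  sides of a constraint: they are arbitrary functions of the vector of decision variables.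
\<close>

record 'i program =
  variables :: "'i set"
  kind :: "'i \<Rightarrow> var_kind"
  objective :: "('i \<Rightarrow> real) \<Rightarrow> real"
  constraints :: "'i constr set"

fun satisfies :: "('i \<Rightarrow> real) \<Rightarrow> 'i constr \<Rightarrow> bool" where
  "satisfies z (Leq f g) \<longleftrightarrow> f z \<le> g z"
| "satisfies z (Eq f g) \<longleftrightarrow> f z = g z"

definition feasible_points :: "'i program \<Rightarrow> ('i \<Rightarrow> real) set" where
  "feasible_points P =
     {z. (\<forall>i\<in>variables P. z i \<in> kind_domain (kind P i)) \<and> (\<forall>k\<in>constraints P. satisfies z k)}"

definition optimal_value :: "'i program \<Rightarrow> real \<Rightarrow> bool" where
  "optimal_value P m \<longleftrightarrow> is_maximum (objective P ` feasible_points P) m"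

definition linear_in :: "'i set \<Rightarrow> (('i \<Rightarrow> real) \<Rightarrow> real) \<Rightarrow> bool" where
  "linear_in J f \<longleftrightarrow> (\<exists>a. \<forall>z. f z = (\<Sum>i\<in>J. a i * z i))"

definition affine_in :: "'i set \<Rightarrow> (('i \<Rightarrow> real) \<Rightarrow> real) \<Rightarrow> bool" where
  "affine_in J f \<longleftrightarrow> (\<exists>a b. \<forall>z. f z = (\<Sum>i\<in>J. a i * z i) + b)"

fun linear_constr :: "'i set \<Rightarrow> 'i constr \<Rightarrow> bool" where
  "linear_constr J (Leq f g) \<longleftrightarrow> affine_in J f \<and> affine_in J g"
| "linear_constr J (Eq f g) \<longleftrightarrow> affine_in J f \<and> affine_in J g"

definition is_MILP :: "'i program \<Rightarrow> bool" where
  "is_MILP P \<longleftrightarrow>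
     finite (variables P) \<and> finite (constraints P) \<and>
     linear_in (variables P) (objective P) \<and>
     (\<forall>k\<in>constraints P. linear_constr (variables P) k)"

section \<open>BDAM instances\<close>

text \<open>
  Edges are two-element sets of nodes.  The symmetric edge data \<open>d(u,v) = d(v,u)\<close> and
  \<open>y(u,v) = y(v,u)\<close> are functions of the edge \<open>{u,v}\<close>.  Values of functions
  outside the relevant index set (such as \<open>X v\<close> for a non-node \<open>v\<close>) never matter.
\<close>

record ('v, 'j) bdam =
  nodes :: "'v set"
  edges :: "'v set set"
  len :: "'v set \<Rightarrow> real"
  source :: 'v
  terminal :: 'v
  elig_nodes :: "'v set"
  elig_edges :: "'v set set"
  budget :: real
  supplies :: "'j set"
  capacity :: "'j \<Rightarrow> real"
  weight1 :: real
  weight2 :: real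

definition bdam_instance :: "('v, 'j) bdam \<Rightarrow> bool" where
  "bdam_instance B \<longleftrightarrow>
     finite (nodes B) \<and>
     edges B \<subseteq> {{u, v} | u v. u \<in> nodes B \<and> v \<in> nodes B \<and> u \<noteq> v} \<and>
     (\<forall>e\<in>edges B. len B e > 0) \<and>
     source B \<in> nodes B \<and> terminal B \<in> nodes B \<and> source B \<noteq> terminal B \<and>
     (source B, terminal B) \<in> {(u, v). {u, v} \<in> edges B}\<^sup>* \<and>
     elig_nodes B \<subseteq> nodes B \<and> elig_edges B \<subseteq> edges B \<and>
     budget B \<ge> 0 \<and>
     finite (supplies B) \<and> (\<forall>j\<in>supplies B. capacity B j \<ge> 0) \<and>
     weight1 B \<ge> 0 \<and> weight2 B \<ge> 0"

definition defender_plan :: "('v, 'j) bdam \<Rightarrow> ('v \<Rightarrow> real) \<Rightarrow> ('v set \<Rightarrow> real) \<Rightarrow> bool" where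
  "defender_plan B X y \<longleftrightarrow>
     (\<forall>v\<in>nodes B. X v \<in> {0, 1}) \<and> (\<forall>v\<in>nodes B - elig_nodes B. X v = 0) \<and>
     (\<forall>e\<in>edges B. y e \<in> {0, 1}) \<and> (\<forall>e\<in>edges B - elig_edges B. y e = 0)"

definition feasible ::
  "('v, 'j) bdam \<Rightarrow> ('v \<Rightarrow> real) \<Rightarrow> ('v set \<Rightarrow> real) \<Rightarrow> ('v \<Rightarrow> 'j \<Rightarrow> real) \<Rightarrow> bool" where
  "feasible B X y I \<longleftrightarrow>
     defender_plan B X y \<and>
     (\<forall>v\<in>nodes B. \<forall>j\<in>supplies B. I v j \<in> {0, 1}) \<and>
     (\<Sum>e\<in>edges B. y e) \<le> budget B \<and>
     (\<forall>v\<in>nodes B. (\<Sum>j\<in>supplies B. I v j) = X v) \<and>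
     (\<forall>j\<in>supplies B. (\<Sum>v\<in>nodes B. I v j) \<le> capacity B j)"

definition delta_A ::
  "('v, 'j) bdam \<Rightarrow> ('v \<Rightarrow> real) \<Rightarrow> ('v set \<Rightarrow> real) \<Rightarrow> 'v \<Rightarrow> 'v \<Rightarrow> real" where
  "delta_A B X y u v = len B {u, v} * (1 + weight1 B * X v + weight2 B * y {u, v})"

definition st_paths :: "('v, 'j) bdam \<Rightarrow> 'v list set" where
  "st_paths B =
     {p. p \<noteq> [] \<and> hd p = source B \<and> last p = terminal B \<and> distinct p \<and> set p \<subseteq> nodes B \<and>
         successively (\<lambda>u v. {u, v} \<in> edges B) p}"

definition path_length ::
  "('v, 'j) bdam \<Rightarrow> ('v \<Rightarrow> real) \<Rightarrow> ('v set \<Rightarrow> real) \<Rightarrow> 'v list \<Rightarrow> real" where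
  "path_length B X y p = (\<Sum>(u, v)\<leftarrow>zip p (tl p). delta_A B X y u v)"

definition H :: "('v, 'j) bdam \<Rightarrow> ('v \<Rightarrow> real) \<Rightarrow> ('v set \<Rightarrow> real) \<Rightarrow> real" where
  "H B X y = Min (path_length B X y ` st_paths B)"

definition H_star :: "('v, 'j) bdam \<Rightarrow> real" where
  "H_star B = Max {H B X y | X y I. feasible B X y I}"

definition potential ::
  "('v, 'j) bdam \<Rightarrow> ('v \<Rightarrow> real) \<Rightarrow> ('v set \<Rightarrow> real) \<Rightarrow> ('v \<Rightarrow> real) \<Rightarrow> bool" where
  "potential B X y \<pi> \<longleftrightarrow>
     \<pi> (source B) = 0 \<and>
     (\<forall>u v. {u, v} \<in> edges B \<longrightarrow> \<pi> v - \<pi> u \<le> delta_A B X y u v)"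

section \<open>The single-level problem as a mathematical program\<close>

datatype ('v, 'j) var = XV 'v | YV "'v set" | IV 'v 'j | PV 'v

fun assemble ::
  "('v \<Rightarrow> real) \<Rightarrow> ('v set \<Rightarrow> real) \<Rightarrow> ('v \<Rightarrow> 'j \<Rightarrow> real) \<Rightarrow> ('v \<Rightarrow> real) \<Rightarrow> ('v, 'j) var \<Rightarrow> real" where
  "assemble X y I \<pi> (XV v) = X v"
| "assemble X y I \<pi> (YV e) = y e"
| "assemble X y I \<pi> (IV v j) = I v j"
| "assemble X y I \<pi> (PV v) = \<pi> v"

fun bdam_kind :: "('v, 'j) var \<Rightarrow> var_kind" where
  "bdam_kind (XV v) = Binary"
| "bdam_kind (YV e) = Binary"
| "bdam_kind (IV v j) = Binary"
| "bdam_kind (PV v) = Continuous"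

definition single_level :: "('v, 'j) bdam \<Rightarrow> ('v, 'j) var program" where
  "single_level B =
    \<lparr> variables = XV ` nodes B \<union> YV ` edges B \<union> {IV v j | v j. v \<in> nodes B \<and> j \<in> supplies B}
                    \<union> PV ` nodes B,
      kind = bdam_kind,
      objective = (\<lambda>z. z (PV (terminal B))),
      constraints =
        {Eq (\<lambda>z. z (XV v)) (\<lambda>z. 0) | v. v \<in> nodes B - elig_nodes B} \<union>
        {Eq (\<lambda>z. z (YV e)) (\<lambda>z. 0) | e. e \<in> edges B - elig_edges B} \<union>
        {Leq (\<lambda>z. \<Sum>e\<in>edges B. z (YV e)) (\<lambda>z. budget B)} \<union>
        {Eq (\<lambda>z. \<Sum>j\<in>supplies B. z (IV v j)) (\<lambda>z. z (XV v)) | v. v \<in> nodes B} \<union>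
        {Leq (\<lambda>z. \<Sum>v\<in>nodes B. z (IV v j)) (\<lambda>z. capacity B j) | j. j \<in> supplies B} \<union>
        {Eq (\<lambda>z. z (PV (source B))) (\<lambda>z. 0)} \<union>
        {Leq (\<lambda>z. z (PV v) - z (PV u))
             (\<lambda>z. len B {u, v} * (1 + weight1 B * z (XV v) + weight2 B * z (YV {u, v})))
          | u v. {u, v} \<in> edges B} \<rparr>"

end

theory Submission
  imports Defs
begin

text \<open>
  Telescoping the constraints along a path shows that \<open>\<pi>\<close> at the terminal is at most the
  length of any path, and the shortest-path distances from the source (extended by \<open>0\<close> to the
  unreachable nodes) form a potential attaining this bound.  A maximum over the defender's
  decisions exists because \<open>H\<close> depends only on the sets of interdicted nodes and destroyed edges.
\<close>

section \<open>Paths and potentials\<close>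

text \<open>Allowing any end node makes it possible to induct along edges and to define a distance
  for every node. Simple paths form a finite set, so minima exist.\<close>

definition simple_paths :: "('v, 'j) bdam \<Rightarrow> 'v \<Rightarrow> 'v list set" where
  "simple_paths B v =
     {p. p \<noteq> [] \<and> hd p = source B \<and> last p = v \<and> distinct p \<and> set p \<subseteq> nodes B \<and>
         successively (\<lambda>u v. {u, v} \<in> edges B) p}"

lemma st_paths_eq: "st_paths B = simple_paths B (terminal B)"
  by (simp add: st_paths_def simple_paths_def)

lemma edge_nodes:
  assumes "bdam_instance B" "{u, v} \<in> edges B"
  shows "u \<in> nodes B" "v \<in> nodes B"
proof -
  obtain a b where "{u, v} = {a, b}" "a \<in> nodes B" "b \<in> nodes B"
    using assms unfolding bdam_instance_def by blast
  then show "u \<in> nodes B" "v \<in> nodes B" by (auto simp: doubleton_eq_iff)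
qed

lemma finite_edges:
  assumes "bdam_instance B"
  shows "finite (edges B)"
proof -
  have "edges B \<subseteq> Pow (nodes B)" "finite (nodes B)"
    using assms unfolding bdam_instance_def by auto
  then show ?thesis by (meson finite_Pow_iff finite_subset)
qed

lemma finite_simple_paths:
  assumes "bdam_instance B"
  shows "finite (simple_paths B v)"
proof -
  have "finite (nodes B)" using assms by (simp add: bdam_instance_def)
  then have "finite {p. set p \<subseteq> nodes B \<and> distinct p}"
    by (rule finite_subset_distinct)
  then show ?thesis by (rule rev_finite_subset) (auto simp: simple_paths_def)
qed

text \<open>The signs of the lengths and weights enter the development only through this
  bound.\<close>

lemma delta_A_nonneg:
  assumes "bdam_instance B" "defender_plan B X y" "{u, v} \<in> edges B"
  shows "0 \<le> delta_A B X y u v"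
proof -
  have "v \<in> nodes B" using edge_nodes(2) assms(1,3) by metis
  then have "0 \<le> X v" "0 \<le> y {u, v}"
    using assms(2,3) unfolding defender_plan_def by fastforce+
  moreover have "0 < len B {u, v}" "0 \<le> weight1 B" "0 \<le> weight2 B"
    using assms(1,3) by (auto simp: bdam_instance_def)
  ultimately show ?thesis by (simp add: delta_A_def)
qed

lemma path_length_snoc:
  assumes "p \<noteq> []"
  shows "path_length B X y (p @ [v]) = path_length B X y p + delta_A B X y (last p) v"
  using assms
proof (induction p)
  case (Cons a p)
  then show ?case by (cases p) (auto simp: path_length_def)
qed simp

text \<open>Each node appended to \<open>q\<close> adds one nonnegative edge length; this justifies
  cutting a path short in \<open>simple_paths_step\<close>.\<close>

lemma path_length_prefix_le:
  assumes "bdam_instance B" "defender_plan B X y" "q \<noteq> []"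
    and "successively (\<lambda>u v. {u, v} \<in> edges B) (q @ r)"
  shows "path_length B X y q \<le> path_length B X y (q @ r)"
  using assms(4)
proof (induction r rule: rev_induct)
  case (snoc x r)
  have "successively (\<lambda>u v. {u, v} \<in> edges B) ((q @ r) @ [x])"
    using snoc.prems by simp
  then have edges: "successively (\<lambda>u v. {u, v} \<in> edges B) (q @ r)" "{last (q @ r), x} \<in> edges B"
    using assms(3) by (auto simp only: successively_append_iff) auto
  have "path_length B X y (q @ (r @ [x])) =
      path_length B X y (q @ r) + delta_A B X y (last (q @ r)) x"
    using path_length_snoc[of "q @ r"] assms(3) by simp
  then show ?case using snoc.IH[OF edges(1)] delta_A_nonneg[OF assms(1,2) edges(2)] by linarith
qed simp

text \<open>Appending \<open>v\<close> breaks simplicity only if \<open>p\<close> has already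
  visited \<open>v\<close>; then the part of \<open>p\<close> up to \<open>v\<close> serves instead
  and is no longer than \<open>p\<close>.\<close>

lemma simple_paths_step:
  assumes "bdam_instance B" "defender_plan B X y"
    and "p \<in> simple_paths B u" "{u, v} \<in> edges B"
  obtains q where "q \<in> simple_paths B v"
    "path_length B X y q \<le> path_length B X y p + delta_A B X y u v"
proof (cases "v \<in> set p")
  case False
  have "p @ [v] \<in> simple_paths B v"
    using assms False edge_nodes[OF assms(1,4)]
    by (auto simp: simple_paths_def successively_append_iff)
  moreover have "path_length B X y (p @ [v]) = path_length B X y p + delta_A B X y u v"
    using assms(3) by (auto simp: simple_paths_def path_length_snoc)
  ultimately show ?thesis using that by simp
next
  case True
  then obtain q r where p: "p = (q @ [v]) @ r" by (auto dest: split_list)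
  have "q @ [v] \<in> simple_paths B v"
    using assms(3) unfolding p simple_paths_def
    by (auto simp: successively_append_iff hd_append split: if_splits)
  moreover have "path_length B X y (q @ [v]) \<le> path_length B X y p"
    unfolding p using assms(3) p
    by (intro path_length_prefix_le[OF assms(1,2)]) (auto simp: simple_paths_def)
  ultimately show ?thesis using that delta_A_nonneg[OF assms(1,2,4)] by fastforce
qed

text \<open>Supplies a plan for \<open>simple_paths_step\<close> when only the existence of paths
  matters.\<close>

lemma defender_plan_zero: "defender_plan B (\<lambda>_. 0) (\<lambda>_. 0)"
  by (simp add: defender_plan_def)

lemma simple_paths_source:
  assumes "bdam_instance B"
  shows "[source B] \<in> simple_paths B (source B)"
  using assms by (simp add: simple_paths_def bdam_instance_def)

text \<open>Reachability in the transitive closure only gives a walk;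
  \<open>simple_paths_step\<close> keeps the path simple as the induction adds one edge at a
  time.\<close>

lemma st_paths_nonempty:
  assumes "bdam_instance B"
  shows "st_paths B \<noteq> {}"
proof -
  have "(source B, terminal B) \<in> {(u, v). {u, v} \<in> edges B}\<^sup>*"
    using assms by (simp add: bdam_instance_def)
  then have "simple_paths B (terminal B) \<noteq> {}"
  proof (induction rule: rtrancl_induct)
    case base
    then show ?case using simple_paths_source[OF assms] by auto
  next
    case (step u v)
    then obtain p where "p \<in> simple_paths B u" "{u, v} \<in> edges B" by auto
    then show ?case using simple_paths_step[OF assms defender_plan_zero] by (metis empty_iff)
  qed
  then show ?thesis by (simp add: st_paths_eq)
qed

section \<open>Duality between potentials and shortest paths\<close>

lemma potential_le_path_length:
  assumes "potential B X y \<pi>" "p \<noteq> []" "successively (\<lambda>u v. {u, v} \<in> edges B) p"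
  shows "\<pi> (last p) - \<pi> (hd p) \<le> path_length B X y p"
  using assms(2,3)
proof (induction p rule: rev_nonempty_induct)
  case (snoc x p)
  then have "{last p, x} \<in> edges B" "successively (\<lambda>u v. {u, v} \<in> edges B) p"
    by (auto simp: successively_append_iff)
  then have "\<pi> x - \<pi> (last p) \<le> delta_A B X y (last p) x"
    "\<pi> (last p) - \<pi> (hd p) \<le> path_length B X y p"
    using assms(1) snoc.IH by (auto simp: potential_def)
  then show ?case using snoc.hyps path_length_snoc[of p B X y x] by simp
qed (simp add: path_length_def)

text \<open>\<open>Min\<close> of the empty set is unspecified, hence the guard. The value 0 is a
  convention; \<open>distance_step\<close> shows that it violates no constraint.\<close>

definition distance :: "('v, 'j) bdam \<Rightarrow> ('v \<Rightarrow> real) \<Rightarrow> ('v set \<Rightarrow> real) \<Rightarrow> 'v \<Rightarrow> real" where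
  "distance B X y v =
     (if simple_paths B v = {} then 0 else Min (path_length B X y ` simple_paths B v))"

lemma distance_terminal:
  assumes "bdam_instance B"
  shows "distance B X y (terminal B) = H B X y"
  using st_paths_nonempty[OF assms] by (simp add: distance_def H_def st_paths_eq)

lemma distance_source:
  assumes "bdam_instance B"
  shows "distance B X y (source B) = 0"
proof -
  \<comment> \<open>A distinct list whose first and last entries coincide has length one.\<close>
  have "p = [source B]" if "p \<in> simple_paths B (source B)" for p
    using that unfolding simple_paths_def by (cases p) (auto split: if_splits dest: last_in_set)
  then have "simple_paths B (source B) = {[source B]}"
    using simple_paths_source[OF assms] by blast
  then show ?thesis by (simp add: distance_def path_length_def)
qed

lemma distance_step:
  assumes "bdam_instance B" "defender_plan B X y" "{u, v} \<in> edges B"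
  shows "distance B X y v \<le> distance B X y u + delta_A B X y u v"
proof (cases "simple_paths B u = {}")
  case True
  \<comment> \<open>Edges are undirected: a simple path to \<open>v\<close> would yield one to
    \<open>u\<close> over the same edge. So both distances are the default 0, and nonnegativity of
    \<open>delta_A\<close> suffices.\<close>
  then have "simple_paths B v = {}"
    using simple_paths_step[OF assms(1,2), of _ v u] assms(3)
    by (metis all_not_in_conv insert_commute)
  then show ?thesis using True delta_A_nonneg[OF assms] by (simp add: distance_def)
next
  case False
  then have "Min (path_length B X y ` simple_paths B u) \<in> path_length B X y ` simple_paths B u"
    using finite_simple_paths[OF assms(1)] by (intro Min_in) auto
  then obtain p where p: "p \<in> simple_paths B u" "distance B X y u = path_length B X y p"
    using False by (auto simp: distance_def)
  obtain q where q: "q \<in> simple_paths B v"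
    "path_length B X y q \<le> path_length B X y p + delta_A B X y u v"
    using simple_paths_step[OF assms(1,2) p(1) assms(3)] .
  have "distance B X y v \<le> path_length B X y q"
    using q(1) finite_simple_paths[OF assms(1)] by (auto simp: distance_def intro!: Min_le)
  then show ?thesis using q(2) p(2) by linarith
qed

lemma potential_distance:
  assumes "bdam_instance B" "defender_plan B X y"
  shows "potential B X y (distance B X y)"
  using distance_source[OF assms(1)] distance_step[OF assms] by (auto simp: potential_def algebra_simps)

lemma potential_le_H:
  assumes "bdam_instance B" "potential B X y \<pi>"
  shows "\<pi> (terminal B) \<le> H B X y"
proof -
  have "\<pi> (terminal B) \<le> path_length B X y p" if "p \<in> st_paths B" for p
    using potential_le_path_length[OF assms(2), of p] that assms(2)
    by (auto simp: st_paths_def potential_def)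
  then show ?thesis
    using finite_simple_paths[OF assms(1)] st_paths_nonempty[OF assms(1)]
    by (auto simp: H_def st_paths_eq)
qed

text \<open>Strong duality for the shortest-path problem, with the distances as an explicit optimal
  dual solution in place of the duality theorem of linear programming.\<close>

lemma H_is_maximum_potential:
  assumes "bdam_instance B" "defender_plan B X y"
  shows "is_maximum {\<pi> (terminal B) | \<pi>. potential B X y \<pi>} (H B X y)"
  using potential_distance[OF assms] distance_terminal[OF assms(1)] potential_le_H[OF assms(1)]
  unfolding is_maximum_def by (smt (verit) mem_Collect_eq)

section \<open>The maximum over the defender's decisions\<close>

lemma path_length_cong:
  assumes "\<And>v. v \<in> nodes B \<Longrightarrow> X v = X' v" "\<And>e. e \<in> edges B \<Longrightarrow> y e = y' e"
    and "set p \<subseteq> nodes B" "successively (\<lambda>u v. {u, v} \<in> edges B) p"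
  shows "path_length B X y p = path_length B X' y' p"
  using assms(3,4)
proof (induction p rule: rev_induct)
  case (snoc x p)
  show ?case
  proof (cases "p = []")
    case False
    then show ?thesis
      using snoc by (auto simp: path_length_snoc successively_append_iff delta_A_def assms(1,2))
  qed (simp add: path_length_def)
qed (simp add: path_length_def)

text \<open>Plans are total functions with arbitrary values off the nodes and edges; this lets a
  plan be replaced by indicator functions.\<close>

lemma H_cong:
  assumes "\<And>v. v \<in> nodes B \<Longrightarrow> X v = X' v" "\<And>e. e \<in> edges B \<Longrightarrow> y e = y' e"
  shows "H B X y = H B X' y'"
proof -
  have "path_length B X y ` st_paths B = path_length B X' y' ` st_paths B"
    using path_length_cong[OF assms] by (intro image_cong) (auto simp: st_paths_def)
  then show ?thesis by (simp add: H_def)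
qed

text \<open>The functions \<open>X\<close> and \<open>y\<close> can be infinite in number, but being
  binary they enter \<open>H\<close> only through the sets where they equal 1, and there are
  finitely many such pairs of sets.\<close>

lemma finite_H_values:
  assumes "bdam_instance B"
  shows "finite {H B X y | X y I. feasible B X y I}"
proof (rule finite_subset)
  let ?h = "\<lambda>(A, F). H B (\<lambda>v. of_bool (v \<in> A)) (\<lambda>e. of_bool (e \<in> F))"
  show "finite (?h ` (Pow (nodes B) \<times> Pow (edges B)))"
    using assms finite_edges[OF assms] by (simp add: bdam_instance_def)
  show "{H B X y | X y I. feasible B X y I} \<subseteq> ?h ` (Pow (nodes B) \<times> Pow (edges B))"
  proof
    fix m assume "m \<in> {H B X y | X y I. feasible B X y I}"
    then obtain X y where m: "m = H B X y" and plan: "defender_plan B X y"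
      by (auto simp: feasible_def)
    have "H B X y = ?h ({v \<in> nodes B. X v = 1}, {e \<in> edges B. y e = 1})"
      unfolding prod.case
      by (rule H_cong) (use plan in \<open>auto simp: defender_plan_def\<close>)
    then show "m \<in> ?h ` (Pow (nodes B) \<times> Pow (edges B))"
      unfolding m by (rule image_eqI) auto
  qed
qed

text \<open>Ensures that the \<open>Max\<close> in \<open>H_star\<close> is taken over a nonempty
  set.\<close>

lemma feasible_zero:
  assumes "bdam_instance B"
  shows "feasible B (\<lambda>_. 0) (\<lambda>_. 0) (\<lambda>_ _. 0)"
  using assms by (simp add: feasible_def defender_plan_zero bdam_instance_def)

lemma H_star_is_maximum:
  assumes "bdam_instance B"
  shows "is_maximum {H B X y | X y I. feasible B X y I} (H_star B)"
proof -
  have "{H B X y | X y I. feasible B X y I} \<noteq> {}"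
    using feasible_zero[OF assms] by blast
  then show ?thesis
    using finite_H_values[OF assms] unfolding is_maximum_def H_star_def
    by (meson Max_ge Max_in)
qed

text \<open>The inner maximum over \<pi> merges with the outer one: an optimal plan paired with its
  distances attains \<open>H_star\<close>, and any other choice is bounded by the \<open>H\<close>
  of its own plan.\<close>

lemma H_star_is_maximum_potential:
  assumes "bdam_instance B"
  shows "is_maximum {\<pi> (terminal B) | X y I \<pi>. feasible B X y I \<and> potential B X y \<pi>} (H_star B)"
    (is "is_maximum ?S _")
proof -
  have max: "is_maximum {H B X y | X y I. feasible B X y I} (H_star B)"
    by (rule H_star_is_maximum[OF assms])
  then obtain X y I where opt: "H_star B = H B X y" "feasible B X y I"
    by (auto simp: is_maximum_def)
  then have "potential B X y (distance B X y)"
    using potential_distance[OF assms] by (simp add: feasible_def)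
  then have "H_star B \<in> ?S"
    using opt distance_terminal[OF assms, of X y] by (metis (mono_tags, lifting) mem_Collect_eq)
  moreover have "\<pi> (terminal B) \<le> H_star B" if "feasible B X y I" "potential B X y \<pi>" for X y I \<pi>
  proof -
    have "H B X y \<le> H_star B" using max that(1) by (auto simp: is_maximum_def)
    then show ?thesis using potential_le_H[OF assms that(2)] by linarith
  qed
  ultimately show ?thesis by (auto simp: is_maximum_def)
qed

section \<open>The single-level problem\<close>

text \<open>This rule and the next turn quantification over a family of constraints or variables
  into quantification over its indices.\<close>

lemma ball_setcompr: "(\<forall>x\<in>{f a | a. Q a}. P x) \<longleftrightarrow> (\<forall>a. Q a \<longrightarrow> P (f a))"
  by blast

lemma ball_setcompr2: "(\<forall>x\<in>{f a b | a b. Q a b}. P x) \<longleftrightarrow> (\<forall>a b. Q a b \<longrightarrow> P (f a b))"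
  by blast

text \<open>The variable kinds encode binarity, and each constraint family encodes one clause of
  feasibility or of \<open>potential\<close>, so the two sides agree clause by clause.\<close>

lemma assemble_feasible_iff:
  fixes B :: "('v, 'j) bdam"
  shows "assemble X y I \<pi> \<in> feasible_points (single_level B) \<longleftrightarrow>
     feasible B X y I \<and> potential B X y \<pi>"
proof -
  let ?z = "assemble X y I \<pi> :: ('v, 'j) var \<Rightarrow> real"
  have "(\<forall>i\<in>variables (single_level B). ?z i \<in> kind_domain (kind (single_level B) i)) \<longleftrightarrow>
      (\<forall>v\<in>nodes B. X v \<in> {0, 1}) \<and> (\<forall>e\<in>edges B. y e \<in> {0, 1}) \<and>
      (\<forall>v\<in>nodes B. \<forall>j\<in>supplies B. I v j \<in> {0, 1})"
    unfolding single_level_def program.simps ball_Un ball_setcompr2 ball_simps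
    by (simp del: insert_iff) blast
  moreover have "(\<forall>k\<in>constraints (single_level B). satisfies ?z k) \<longleftrightarrow>
      (\<forall>v\<in>nodes B - elig_nodes B. X v = 0) \<and> (\<forall>e\<in>edges B - elig_edges B. y e = 0) \<and>
      (\<Sum>e\<in>edges B. y e) \<le> budget B \<and>
      (\<forall>v\<in>nodes B. (\<Sum>j\<in>supplies B. I v j) = X v) \<and>
      (\<forall>j\<in>supplies B. (\<Sum>v\<in>nodes B. I v j) \<le> capacity B j) \<and>
      potential B X y \<pi>"
    unfolding single_level_def potential_def delta_A_def program.simps ball_Un
      ball_setcompr ball_setcompr2
    by (simp add: Ball_def)
  ultimately show ?thesis
    unfolding feasible_points_def feasible_def defender_plan_def by blast
qed

text \<open>Since every vector is assembled from its four blocks,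
  \<open>assemble_feasible_iff\<close> describes all feasible points.\<close>

lemma assemble_components:
  "z = assemble (\<lambda>v. z (XV v)) (\<lambda>e. z (YV e)) (\<lambda>v j. z (IV v j)) (\<lambda>v. z (PV v))"
proof
  fix i
  show "z i = assemble (\<lambda>v. z (XV v)) (\<lambda>e. z (YV e)) (\<lambda>v j. z (IV v j)) (\<lambda>v. z (PV v)) i"
    by (cases i) auto
qed

lemma objective_assemble: "objective (single_level B) (assemble X y I \<pi>) = \<pi> (terminal B)"
  by (simp add: single_level_def)

lemma objective_image_feasible_points:
  "objective (single_level B) ` feasible_points (single_level B) =
     {\<pi> (terminal B) | X y I \<pi>. feasible B X y I \<and> potential B X y \<pi>}" (is "?L = ?R")
proof (intro equalityI subsetI)
  fix m assume "m \<in> ?L"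
  then obtain z where "z \<in> feasible_points (single_level B)" "m = objective (single_level B) z"
    by auto
  then show "m \<in> ?R"
    using assemble_components[of z] assemble_feasible_iff objective_assemble
    by (smt (verit, best) mem_Collect_eq)
next
  fix m assume "m \<in> ?R"
  then obtain X y I \<pi> where "feasible B X y I" "potential B X y \<pi>" "m = \<pi> (terminal B)"
    by auto
  then show "m \<in> ?L"
    using assemble_feasible_iff[of X y I \<pi> B] objective_assemble[of B X y I \<pi>]
    by (metis image_eqI)
qed

section \<open>Affine functions and the mixed-integer linear form\<close>

lemma linear_in_var:
  assumes "finite J" "i \<in> J"
  shows "linear_in J (\<lambda>z. z i)"
  \<comment> \<open>The coefficient vector is the indicator of \<open>i\<close>; finiteness of
    \<open>J\<close> matters because a sum over an infinite set is 0.\<close>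
  unfolding linear_in_def
  using assms by (intro exI[of _ "\<lambda>k. if k = i then 1 else 0"]) (simp add: if_distribR if_distrib[of "\<lambda>a. a * _"] cong: if_cong)

lemma affine_in_var: "finite J \<Longrightarrow> i \<in> J \<Longrightarrow> affine_in J (\<lambda>z. z i)"
  using linear_in_var unfolding linear_in_def affine_in_def by (metis add.right_neutral)

lemma affine_in_const: "affine_in J (\<lambda>_. c)"
  unfolding affine_in_def by (intro exI[of _ "\<lambda>_. 0"] exI[of _ c]) simp

lemma affine_in_add:
  assumes "affine_in J f" "affine_in J g"
  shows "affine_in J (\<lambda>z. f z + g z)"
proof -
  obtain a b a' b' where "\<And>z. f z = (\<Sum>i\<in>J. a i * z i) + b" "\<And>z. g z = (\<Sum>i\<in>J. a' i * z i) + b'"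
    using assms unfolding affine_in_def by blast
  then have "\<forall>z. f z + g z = (\<Sum>i\<in>J. (a i + a' i) * z i) + (b + b')"
    by (simp add: distrib_right sum.distrib)
  then show ?thesis unfolding affine_in_def
    by (intro exI[of _ "\<lambda>i. a i + a' i"] exI[of _ "b + b'"])
qed

lemma affine_in_cmult:
  assumes "affine_in J f"
  shows "affine_in J (\<lambda>z. c * f z)"
proof -
  obtain a b where "\<And>z. f z = (\<Sum>i\<in>J. a i * z i) + b"
    using assms unfolding affine_in_def by blast
  then have "\<forall>z. c * f z = (\<Sum>i\<in>J. (c * a i) * z i) + c * b"
    by (simp add: distrib_left sum_distrib_left mult.assoc)
  then show ?thesis unfolding affine_in_def
    by (intro exI[of _ "\<lambda>i. c * a i"] exI[of _ "c * b"])
qed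

lemma affine_in_diff:
  assumes "affine_in J f" "affine_in J g"
  shows "affine_in J (\<lambda>z. f z - g z)"
  using affine_in_add[OF assms(1) affine_in_cmult[OF assms(2), of "-1"]] by simp

lemma affine_in_sum:
  assumes "\<And>k. k \<in> K \<Longrightarrow> affine_in J (f k)"
  shows "affine_in J (\<lambda>z. \<Sum>k\<in>K. f k z)"
  using assms
  by (induction K rule: infinite_finite_induct) (auto intro: affine_in_const affine_in_add)

lemma finite_constraints_single_level:
  assumes "bdam_instance B"
  shows "finite (constraints (single_level B))"
proof -
  have fin: "finite (nodes B)" "finite (supplies B)" "finite (edges B)"
    using assms finite_edges[OF assms] by (auto simp: bdam_instance_def)
  \<comment> \<open>The edge constraints are indexed by ordered pairs, two for each edge, so
    finiteness is needed for the pairs.\<close>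
  have "{(u, v). {u, v} \<in> edges B} \<subseteq> nodes B \<times> nodes B"
    using edge_nodes[OF assms] by auto
  then have "finite {(u, v). {u, v} \<in> edges B}"
    using fin(1) by (meson finite_SigmaI finite_subset)
  then have edge_pairs: "finite ((\<lambda>(u, v). C u v) ` {(u, v). {u, v} \<in> edges B})"
    for C :: "'a \<Rightarrow> 'a \<Rightarrow> ('a, 'b) var constr" by (rule finite_imageI)
  have "finite {C u v | u v. {u, v} \<in> edges B}" for C :: "'a \<Rightarrow> 'a \<Rightarrow> ('a, 'b) var constr"
    by (rule finite_subset[OF _ edge_pairs[of C]]) auto
  then show ?thesis
    using fin by (simp add: single_level_def)
qed

text \<open>No constraint multiplies two decision variables: lengths, weights, budget and capacities
  are constants. Hence the affine closure rules apply syntactically.\<close>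

lemma is_MILP_single_level:
  assumes "bdam_instance B"
  shows "is_MILP (single_level B)"
proof -
  let ?J = "variables (single_level B)"
  have fin: "finite (nodes B)" "finite (supplies B)" "finite (edges B)"
    using assms finite_edges[OF assms] by (auto simp: bdam_instance_def)
  have "{IV v j | v j. v \<in> nodes B \<and> j \<in> supplies B} = (\<lambda>(v, j). IV v j) ` (nodes B \<times> supplies B)"
    by auto
  then have finJ: "finite ?J"
    using fin by (simp add: single_level_def)
  have var: "XV v \<in> ?J" "PV v \<in> ?J" if "v \<in> nodes B" for v
    using that by (auto simp: single_level_def)
  have varY: "YV e \<in> ?J" if "e \<in> edges B" for e
    using that by (auto simp: single_level_def)
  have varI: "IV v j \<in> ?J" if "v \<in> nodes B" "j \<in> supplies B" for v j
    using that by (auto simp: single_level_def)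
  have nodes: "source B \<in> nodes B" "terminal B \<in> nodes B"
    using assms by (auto simp: bdam_instance_def)
  (* naming the variable set J keeps it folded when single_level_def is unfolded *)
  have "linear_constr J k"
    if "k \<in> constraints (single_level B)" and J: "J = ?J" for J k
  proof -
    note affine = affine_in_const affine_in_add affine_in_diff affine_in_cmult affine_in_sum
      affine_in_var[OF finJ, folded J]
    note mem = var varY varI nodes
    show ?thesis
      using that(1) unfolding single_level_def
      by (auto intro!: affine mem[folded J] dest: edge_nodes[OF assms])
  qed
  moreover have "linear_in ?J (objective (single_level B))"
    using linear_in_var[OF finJ var(2)[OF nodes(2)]] by (simp add: single_level_def)
  ultimately show ?thesis
    using finJ finite_constraints_single_level[OF assms] by (simp add: is_MILP_def)
qed

text \<open>\<open>is_MILP\<close> does not look at kinds. This lemma and the next one record them;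
  the two sets together exhaust the variables.\<close>

lemma binary_variables_single_level:
  "{i \<in> variables (single_level B). kind (single_level B) i = Binary} =
     XV ` nodes B \<union> YV ` edges B \<union> {IV v j | v j. v \<in> nodes B \<and> j \<in> supplies B}"
  by (auto simp: single_level_def)

lemma continuous_variables_single_level:
  "{i \<in> variables (single_level B). kind (single_level B) i = Continuous} = PV ` nodes B"
  by (auto simp: single_level_def)

theorem mainTheorem1:
  fixes B :: "('v, 'j) bdam"
  assumes "bdam_instance B"
  shows
    "(\<forall>X y. defender_plan B X y \<longrightarrow>
        is_maximum {\<pi> (terminal B) | \<pi>. potential B X y \<pi>} (H B X y)) \<and>
     is_maximum {H B X y | X y I. feasible B X y I} (H_star B) \<and>
     is_maximum {\<pi> (terminal B) | X y I \<pi>. feasible B X y I \<and> potential B X y \<pi>} (H_star B) \<and>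
     (\<forall>X y I \<pi>. assemble X y I \<pi> \<in> feasible_points (single_level B) \<longleftrightarrow>
        feasible B X y I \<and> potential B X y \<pi>) \<and>
     (\<forall>X y I \<pi>. objective (single_level B) (assemble X y I \<pi>) = \<pi> (terminal B)) \<and>
     optimal_value (single_level B) (H_star B) \<and>
     is_MILP (single_level B) \<and>
     {i \<in> variables (single_level B). kind (single_level B) i = Binary} =
       XV ` nodes B \<union> YV ` edges B \<union> {IV v j | v j. v \<in> nodes B \<and> j \<in> supplies B} \<and>
     {i \<in> variables (single_level B). kind (single_level B) i = Continuous} = PV ` nodes B"
proof (intro conjI allI impI)
  show "optimal_value (single_level B) (H_star B)"
    unfolding optimal_value_def objective_image_feasible_points
    by (rule H_star_is_maximum_potential[OF assms])
qed (simp_all only: H_is_maximum_potential[OF assms] H_star_is_maximum[OF assms]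
    H_star_is_maximum_potential[OF assms] assemble_feasible_iff objective_assemble
    is_MILP_single_level[OF assms] binary_variables_single_level continuous_variables_single_level)

end
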